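(* Let $\mathcal Q$ be a logic on a Hilbert space $\mathcal H$. For any $u,v\in\mathbf R^{(\mathcal Q)}$, $$[\![u=v]\!]=\mathcal P\{\psi\in\mathcal H:[\![\check r\in u]\!]\psi=[\![\check r\in v]\!]\psi\text{ for all }r\in\mathbf Q\}.$$
   Context: $\mathcal Q(\mathcal H)$ is the lattice of orthogonal projections on $\mathcal H$ (order by inclusion of ranges, $\wedge,\vee$ and arbitrary $\bigwedge,\bigvee$ via intersection / closed span of union of ranges, $P^\perp=1-P$). $\mathcal P S$ is the projection onto a closed subspace $S$. $\mathcal A^!=\{P\in\mathcal Q(\mathcal H):PQ=QP\ \forall Q\in\mathcal A\}$; a logic is $\mathcal Q\subseteq\mathcal Q(\mathcal H)$ with $\mathcal Q=\mathcal Q^{!!}$. $P\Rightarrow Q=P^\perp\vee(P\wedge Q)$, $P\Leftrightarrow Q=(P\Rightarrow Q)\wedge(Q\Rightarrow P)$. $V^{(\mathcal Q)}=\bigcup_\alpha V^{(\mathcal Q)}_\alpha$, $V^{(\mathcal Q)}_\alpha$ the set of functions $u$ with values in $\mathcal Q$ and $\mathrm{dom}(u)\subseteq\bigcup_{\beta<\alpha}V^{(\mathcal Q)}_\beta$. Truth values: $[\![u=v]\!]=\bigwedge_{u'\in\mathrm{dom}(u)}(u(u')\Rightarrow[\![u'\in v]\!])\wedge\bigwedge_{v'\in\mathrm{dom}(v)}(v(v')\Rightarrow[\![v'\in u]\!])$, $[\![u\in v]\!]=\bigvee_{v'\in\mathrm{dom}(v)}(v(v')\wedge[\![u=v']\!])$,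 $[\![\neg\phi]\!]=[\![\phi]\!]^\perp$, connectives by lattice operations, $[\![(\forall x\in u)\phi]\!]=\bigwedge_{u'\in\mathrm{dom}(u)}(u(u')\Rightarrow[\![\phi(u')]\!])$, $[\![(\exists x\in u)\phi]\!]=\bigvee_{u'\in\mathrm{dom}(u)}(u(u')\wedge[\![\phi(u')]\!])$. For a set $v$, $\check v=\{(\check w,1):w\in v\}$; $\mathbf Q$ is the rationals. $\mathbf R(x)$ is $x\subseteq\check{\mathbf Q}\wedge\exists y\in\check{\mathbf Q}(y\in x)\wedge\exists y\in\check{\mathbf Q}(y\notin x)\wedge\forall y\in\check{\mathbf Q}(y\in x\Leftrightarrow\forall z\in\check{\mathbf Q}(y<z\Rightarrow z\in x))$ ($x\subseteq y$ abbreviates $\forall z\in x(z\in y)$, $<$ the order of rationals); $\mathbf R^{(\mathcal Q)}=\{u\in V^{(\mathcal Q)}:\mathrm{dom}(u)=\{\check r:r\in\mathbf Q\},\ [\![\mathbf R(u)]\!]=1\}$. *)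

theory Defs
  imports
    "HOL-Analysis.Analysis"
    "HOL-Library.Multiset"
    "HOL-Library.Complemented_Lattices"
begin

section \<open>Complex Hilbert spaces\<close>

text \<open>
  The library has real inner product spaces only.  A complex Hilbert space is presented here as a
  complete real inner product space carrying a compatible complex scalar multiplication and a
  sesquilinear form (conjugate-linear in the first argument) whose real part is the real inner
  product.  The norm of the class \<open>real_inner\<close> is then the norm of the complex inner product.
\<close>

class complex_hilbert_space = real_inner + complete_space +
  fixes scaleC :: "complex \<Rightarrow> 'a \<Rightarrow> 'a" (infixr "*\<^sub>C" 75)
    and cinner :: "'a \<Rightarrow> 'a \<Rightarrow> complex"
  assumes scaleR_scaleC: "scaleR r x = complex_of_real r *\<^sub>C x"
    and scaleC_add_right: "c *\<^sub>C (x + y) = c *\<^sub>C x + c *\<^sub>C y"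
    and scaleC_add_left: "(c + d) *\<^sub>C x = c *\<^sub>C x + d *\<^sub>C x"
    and scaleC_scaleC: "c *\<^sub>C (d *\<^sub>C x) = (c * d) *\<^sub>C x"
    and scaleC_one: "1 *\<^sub>C x = x"
    and cinner_commute: "cinner x y = cnj (cinner y x)"
    and cinner_add_right: "cinner x (y + z) = cinner x y + cinner x z"
    and cinner_scaleC_right: "cinner x (c *\<^sub>C y) = c * cinner x y"
    and inner_eq_Re_cinner: "inner x y = Re (cinner x y)"

instantiation complex :: complex_hilbert_space
begin
definition scaleC_complex :: "complex \<Rightarrow> complex \<Rightarrow> complex" where "scaleC_complex c x = c * x"
definition cinner_complex :: "complex \<Rightarrow> complex \<Rightarrow> complex" where "cinner_complex x y = cnj x * y"
instance
  by standard
    (auto simp: scaleC_complex_def cinner_complex_def algebra_simps scaleR_conv_of_real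
      inner_complex_def)
end

lemma cinner_add_left: "cinner (x + y) z = cinner x z + cinner y z"
  by (metis cinner_commute cinner_add_right complex_cnj_add)

lemma cinner_scaleC_left: "cinner (c *\<^sub>C x) y = cnj c * cinner x y"
  by (metis cinner_commute cinner_scaleC_right complex_cnj_mult)

lemma uminus_scaleC: "- (x::'a::complex_hilbert_space) = (- 1) *\<^sub>C x"
  using scaleR_scaleC[of "- 1" x] by simp

lemma cinner_minus_right: "cinner x (- y) = - cinner x y"
  by (simp add: uminus_scaleC[of y] cinner_scaleC_right)

lemma cinner_minus_left: "cinner (- x) y = - cinner x y"
  by (simp add: uminus_scaleC[of x] cinner_scaleC_left)

lemma cinner_diff_right: "cinner x (y - z) = cinner x y - cinner x z"
  using cinner_add_right[of x y "- z"] by (simp add: cinner_minus_right)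

lemma cinner_diff_left: "cinner (x - y) z = cinner x z - cinner y z"
  using cinner_add_left[of x "- y" z] by (simp add: cinner_minus_left)

lemma scaleC_diff_right: "c *\<^sub>C (x - y) = c *\<^sub>C x - c *\<^sub>C y"
  using scaleC_add_right[of c "x - y" y] by (simp add: algebra_simps)

lemma scaleC_zero_right: "c *\<^sub>C 0 = 0"
  using scaleC_diff_right[of c 0 0] by simp

lemma cinner_zero_right: "cinner x 0 = 0"
  using cinner_diff_right[of x 0 0] by simp

lemma cinner_zero_left: "cinner 0 x = 0"
  using cinner_diff_left[of 0 0 x] by simp

lemma cinner_self_eq_0: "cinner x x = 0 \<Longrightarrow> x = 0"
  using inner_eq_Re_cinner[of x x] by simp

lemma cinner_ext: "(\<And>z. cinner z x = cinner z y) \<Longrightarrow> x = y"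
  using cinner_self_eq_0[of "x - y"] by (simp add: cinner_diff_right)

definition csubspace :: "'a::complex_hilbert_space set \<Rightarrow> bool" where
  "csubspace S \<longleftrightarrow>
     0 \<in> S \<and> (\<forall>x\<in>S. \<forall>y\<in>S. x + y \<in> S) \<and> (\<forall>c. \<forall>x\<in>S. c *\<^sub>C x \<in> S)"

definition closed_csubspace :: "'a::complex_hilbert_space set \<Rightarrow> bool" where
  "closed_csubspace S \<longleftrightarrow> csubspace S \<and> closed S"

definition closed_cspan :: "'a::complex_hilbert_space set \<Rightarrow> 'a set" where
  "closed_cspan A = \<Inter>{S. closed_csubspace S \<and> A \<subseteq> S}"

definition orth_projection :: "('a::complex_hilbert_space \<Rightarrow> 'a) \<Rightarrow> bool" where
  "orth_projection P \<longleftrightarrow>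
     (\<forall>x y. P (x + y) = P x + P y) \<and> (\<forall>c x. P (c *\<^sub>C x) = c *\<^sub>C P x) \<and>
     P \<circ> P = P \<and> (\<forall>x y. cinner (P x) y = cinner x (P y))"

lemma csubspace_diff: "csubspace S \<Longrightarrow> x \<in> S \<Longrightarrow> y \<in> S \<Longrightarrow> x - y \<in> S"
  unfolding csubspace_def by (metis add_uminus_conv_diff uminus_scaleC)

lemma csubspace_scaleR: "csubspace S \<Longrightarrow> x \<in> S \<Longrightarrow> scaleR r x \<in> S"
  by (simp add: csubspace_def scaleR_scaleC)

lemma closed_csubspace_Inter:
  "(\<And>S. S \<in> A \<Longrightarrow> closed_csubspace S) \<Longrightarrow> closed_csubspace (\<Inter>A)"
  by (auto simp: closed_csubspace_def csubspace_def)

lemma closed_csubspace_cspan: "closed_csubspace (closed_cspan A)"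
  unfolding closed_cspan_def by (rule closed_csubspace_Inter) auto

lemma closed_cspan_superset: "A \<subseteq> closed_cspan A"
  unfolding closed_cspan_def by auto

lemma closed_cspan_minimal: "closed_csubspace S \<Longrightarrow> A \<subseteq> S \<Longrightarrow> closed_cspan A \<subseteq> S"
  unfolding closed_cspan_def by auto

lemma orth_projection_id: "orth_projection id"
  by (simp add: orth_projection_def)

lemma orth_projection_zero: "orth_projection (\<lambda>x. 0)"
  by (simp add: orth_projection_def comp_def scaleC_zero_right cinner_zero_left cinner_zero_right)

lemma orth_projection_compl:
  assumes "orth_projection P"
  shows "orth_projection (\<lambda>x. x - P x)"
proof -
  have P: "P (x + y) = P x + P y" "P (c *\<^sub>C x) = c *\<^sub>C P x" "P (P x) = P x"
    "cinner (P x) y = cinner x (P y)" for x y c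
    using assms by (simp_all add: orth_projection_def fun_eq_iff)
  have "P (x - P x) = 0" for x using P(1)[of "x - P x" "P x"] by (simp add: P(3))
  then show ?thesis
    unfolding orth_projection_def
    by (simp add: fun_eq_iff P scaleC_diff_right cinner_diff_left cinner_diff_right add_diff_add)
qed

lemma parallelogram_midpoint:
  fixes a b x :: "'a::real_inner"
  shows "(norm (a - b))\<^sup>2
    = 2 * (norm (x - a))\<^sup>2 + 2 * (norm (x - b))\<^sup>2 - 4 * (norm (x - (1/2) *\<^sub>R (a + b)))\<^sup>2"
  by (simp add: power2_norm_eq_inner inner_diff_left inner_diff_right inner_add_left
      inner_add_right inner_commute algebra_simps)

lemma closest_point_exists_csubspace:
  fixes S :: "'a::complex_hilbert_space set"
  assumes S: "closed_csubspace S"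
  shows "\<exists>s\<in>S. \<forall>z\<in>S. norm (x - s) \<le> norm (x - z)"
proof -
  have cs: "csubspace S" and cl: "closed S" and ne: "S \<noteq> {}"
    using S by (auto simp: closed_csubspace_def csubspace_def)
  define d where "d = infdist x S"
  have d_le: "d \<le> norm (x - z)" if "z \<in> S" for z
    using infdist_le[OF that, of x] by (simp add: d_def dist_norm)
  have d0: "0 \<le> d" by (simp add: d_def infdist_nonneg)
  have "\<exists>s\<in>S. norm (x - s) < d + 1 / real (Suc n)" for n
    using cInf_lessD[of "dist x ` S" "d + 1 / real (Suc n)"] ne
    by (auto simp: d_def infdist_notempty dist_norm)
  then obtain s where s: "\<And>n. s n \<in> S" "\<And>n. norm (x - s n) < d + 1 / real (Suc n)" by metis
  have mid: "d \<le> norm (x - (1/2) *\<^sub>R (a + b))" if "a \<in> S" "b \<in> S" for a b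
    using that cs by (intro d_le csubspace_scaleR) (auto simp: csubspace_def)
  have lim: "(\<lambda>n. norm (x - s n)) \<longlonglongrightarrow> d"
  proof (rule tendsto_sandwich)
    show "\<forall>\<^sub>F n in sequentially. d \<le> norm (x - s n)" using d_le[OF s(1)] by simp
    show "\<forall>\<^sub>F n in sequentially. norm (x - s n) \<le> d + 1 / real (Suc n)"
      using s(2) by (intro always_eventually allI less_imp_le)
    show "(\<lambda>n. d + 1 / real (Suc n)) \<longlonglongrightarrow> d"
      using tendsto_add[OF tendsto_const[of d] LIMSEQ_inverse_real_of_nat]
      by (simp add: inverse_eq_divide)
    show "(\<lambda>n. d) \<longlonglongrightarrow> d" by simp
  qed
  have "Cauchy s"
  proof (rule CauchyI)
    fix e :: real assume e: "0 < e"
    have "(\<lambda>n. (norm (x - s n))\<^sup>2) \<longlonglongrightarrow> d\<^sup>2" by (intro tendsto_intros lim)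
    then have "\<forall>\<^sub>F n in sequentially. (norm (x - s n))\<^sup>2 < d\<^sup>2 + e\<^sup>2 / 4"
      by (rule order_tendstoD) (use e in auto)
    then obtain N where N: "\<And>n. n \<ge> N \<Longrightarrow> (norm (x - s n))\<^sup>2 < d\<^sup>2 + e\<^sup>2 / 4"
      by (auto simp: eventually_sequentially)
    show "\<exists>M. \<forall>m\<ge>M. \<forall>n\<ge>M. norm (s m - s n) < e"
    proof (intro exI allI impI)
      fix m n assume mn: "m \<ge> N" "n \<ge> N"
      have "d\<^sup>2 \<le> (norm (x - (1/2) *\<^sub>R (s m + s n)))\<^sup>2"
        using mid[OF s(1) s(1)] d0 by (intro power_mono)
      then have "(norm (s m - s n))\<^sup>2 < e\<^sup>2"
        using parallelogram_midpoint[of "s m" "s n" x] N[OF mn(1)] N[OF mn(2)] by linarith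
      then show "norm (s m - s n) < e" using e by (simp add: power_less_imp_less_base)
    qed
  qed
  then obtain l where l: "s \<longlonglongrightarrow> l" using Cauchy_convergent convergent_def by blast
  have "l \<in> S" using closed_sequentially[OF cl _ l] s(1) by blast
  moreover have "(\<lambda>n. norm (x - s n)) \<longlonglongrightarrow> norm (x - l)" by (intro tendsto_intros l)
  then have "norm (x - l) = d" using lim LIMSEQ_unique by blast
  ultimately show ?thesis using d_le by auto
qed

lemma orth_decomposition:
  fixes S :: "'a::complex_hilbert_space set"
  assumes S: "closed_csubspace S"
  shows "\<exists>s\<in>S. \<forall>z\<in>S. cinner z (x - s) = 0"
proof -
  have cs: "csubspace S" using S by (simp add: closed_csubspace_def)
  obtain s where s: "s \<in> S" "\<And>z. z \<in> S \<Longrightarrow> norm (x - s) \<le> norm (x - z)"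
    using closest_point_exists_csubspace[OF S] by blast
  have inner0: "inner z (x - s) = 0" if z: "z \<in> S" for z
  proof (rule ccontr)
    assume ne: "inner z (x - s) \<noteq> 0"
    define a where "a = inner z (x - s)"
    define t where "t = a / inner z z"
    have zz: "inner z z > 0" using ne by auto
    have "s + t *\<^sub>R z \<in> S"
      using cs s(1) csubspace_scaleR[OF cs z] by (auto simp: csubspace_def)
    then have "(norm (x - s))\<^sup>2 \<le> (norm ((x - s) - t *\<^sub>R z))\<^sup>2"
      using s(2) by (intro power_mono) (auto simp: algebra_simps)
    also have "\<dots> = (norm (x - s))\<^sup>2 - 2 * t * a + t\<^sup>2 * inner z z"
      unfolding power2_norm_eq_inner a_def
      by (simp add: inner_diff_left inner_diff_right inner_commute power2_eq_square algebra_simps)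
    also have "t\<^sup>2 * inner z z = t * a" using zz by (simp add: t_def power2_eq_square)
    finally have "a * a / inner z z \<le> 0" by (simp add: t_def)
    moreover have "a * a / inner z z > 0"
      using zz ne by (intro divide_pos_pos) (simp_all add: a_def flip: power2_eq_square)
    ultimately show False by simp
  qed
  have "cinner z (x - s) = 0" if z: "z \<in> S" for z
  proof (rule complex_eqI)
    show "Re (cinner z (x - s)) = Re 0"
      using inner0[OF z] by (simp add: inner_eq_Re_cinner)
    have "\<i> *\<^sub>C z \<in> S" using cs z by (simp add: csubspace_def)
    from inner0[OF this] show "Im (cinner z (x - s)) = Im 0"
      by (simp add: inner_eq_Re_cinner cinner_scaleC_left)
  qed
  then show ?thesis using s(1) by blast
qed

section \<open>The lattice of projections\<close>

typedef (overloaded) 'h qproj = "{P :: 'h::complex_hilbert_space \<Rightarrow> 'h. orth_projection P}"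
  morphisms op Abs_qproj
  using orth_projection_id by blast

setup_lifting type_definition_qproj

abbreviation ran_op :: "'h::complex_hilbert_space qproj \<Rightarrow> 'h set" where
  "ran_op P \<equiv> range (op P)"

definition proj_onto :: "'h::complex_hilbert_space set \<Rightarrow> 'h qproj" where
  "proj_onto S = (THE P. ran_op P = S)"

lemma op_add: "op P (x + y) = op P x + op P y"
  and op_scaleC: "op P (c *\<^sub>C x) = c *\<^sub>C op P x"
  and op_idem [simp]: "op P (op P x) = op P x"
  and op_cinner: "cinner (op P x) y = cinner x (op P y)"
  using op[of P] by (auto simp: orth_projection_def fun_eq_iff)

lemma op_diff: "op P (x - y) = op P x - op P y"
  using op_add[of P "x - y" y] by (simp add: algebra_simps)

lemma op_zero [simp]: "op P 0 = 0"
  using op_diff[of P 0 0] by simp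

lemma mem_ran_op: "x \<in> ran_op P \<longleftrightarrow> op P x = x"
proof
  show "x \<in> ran_op P \<Longrightarrow> op P x = x" by auto
  show "op P x = x \<Longrightarrow> x \<in> ran_op P" using rangeI[of "op P" x] by simp
qed

lemma op_eqI:
  assumes "s \<in> ran_op P" and "\<And>z. z \<in> ran_op P \<Longrightarrow> cinner z (x - s) = 0"
  shows "op P x = s"
proof (rule cinner_ext)
  fix z
  have "cinner z (op P x) = cinner (op P z) x" by (simp add: op_cinner)
  also have "\<dots> = cinner (op P z) s" using assms(2)[of "op P z"] by (simp add: cinner_diff_right)
  also have "\<dots> = cinner z (op P s)" by (simp add: op_cinner)
  also have "op P s = s" using assms(1) by (simp add: mem_ran_op)
  finally show "cinner z (op P x) = cinner z s" .
qed

lemma op_orth: "z \<in> ran_op P \<Longrightarrow> cinner z (x - op P x) = 0"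
  using op_cinner[of P z x] by (simp add: cinner_diff_right mem_ran_op)

lemma qproj_eqI:
  assumes "ran_op P = ran_op Q"
  shows "P = Q"
proof -
  have "op P x = op Q x" for x
    by (rule op_eqI) (use assms in \<open>auto intro: op_orth\<close>)
  then show ?thesis by (simp add: op_inject[symmetric] fun_eq_iff)
qed

lemma closed_csubspace_ran: "closed_csubspace (ran_op P)"
proof -
  have "csubspace (ran_op P)"
    unfolding csubspace_def mem_ran_op by (simp add: op_add op_scaleC)
  moreover have "closed (ran_op P)"
    unfolding closed_sequential_limits
  proof (intro allI impI; elim conjE)
    fix s l assume s: "\<forall>n. s n \<in> ran_op P" and l: "s \<longlonglongrightarrow> l"
    have nm: "norm (op P x) \<le> norm x" for x
    proof -
      have "inner (op P x) (x - op P x) = 0"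
        using op_orth[of "op P x" P x] by (simp add: inner_eq_Re_cinner)
      then have "(norm (op P x))\<^sup>2 \<le> norm (op P x) * norm x"
        using norm_cauchy_schwarz[of "op P x" x]
        by (simp add: inner_diff_right power2_norm_eq_inner)
      then show ?thesis
        by (cases "norm (op P x) = 0") (auto simp: power2_eq_square mult_le_cancel_left)
    qed
    have "(\<lambda>n. norm (s n - l)) \<longlonglongrightarrow> 0" using l by (intro tendsto_norm_zero LIM_zero)
    then have "(\<lambda>n. op P (s n - l)) \<longlonglongrightarrow> 0"
      by (rule Lim_null_comparison[OF always_eventually, rotated]) (use nm in blast)
    then have "(\<lambda>n. s n - op P l) \<longlonglongrightarrow> 0"
      using s by (simp add: op_diff mem_ran_op)
    then have "s \<longlonglongrightarrow> op P l" by (simp add: LIM_zero_iff)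
    then show "l \<in> ran_op P" using l LIMSEQ_unique by blast
  qed
  ultimately show ?thesis by (simp add: closed_csubspace_def)
qed

lemma projection_exists:
  fixes S :: "'h::complex_hilbert_space set"
  assumes S: "closed_csubspace S"
  shows "\<exists>P. ran_op P = S"
proof -
  have cs: "csubspace S" using S by (simp add: closed_csubspace_def)
  obtain p where p: "\<And>x. p x \<in> S" "\<And>x z. z \<in> S \<Longrightarrow> cinner z (x - p x) = 0"
    using orth_decomposition[OF S] by metis
  have uniq: "p x = s" if "s \<in> S" "\<And>z. z \<in> S \<Longrightarrow> cinner z (x - s) = 0" for x s
  proof -
    have m: "p x - s \<in> S" using csubspace_diff[OF cs] p(1) that(1) by blast
    have "cinner (p x - s) (p x - s) = cinner (p x - s) ((x - s) - (x - p x))" by simp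
    also have "\<dots> = 0" unfolding cinner_diff_right[of _ "x - s"] using m p(2) that(2) by simp
    finally show ?thesis using cinner_self_eq_0 by force
  qed
  have orth: "orth_projection p"
    unfolding orth_projection_def
  proof (intro conjI allI)
    fix x y c
    show "p (x + y) = p x + p y"
      using cs p by (intro uniq) (auto simp: csubspace_def add_diff_add cinner_add_right)
    show "p (c *\<^sub>C x) = c *\<^sub>C p x"
      using cs p
      by (intro uniq)
        (auto simp: csubspace_def cinner_scaleC_right simp flip: scaleC_diff_right)
    show "p \<circ> p = p" using p by (auto simp: fun_eq_iff cinner_zero_right intro!: uniq)
    have "cinner (p x) (y - p y) = 0" "cinner (p y) (x - p x) = 0" using p by auto
    then have "cinner (p x) y = cinner (p x) (p y)" "cinner (p y) x = cinner (p y) (p x)"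
      by (simp_all add: cinner_diff_right)
    then show "cinner (p x) y = cinner x (p y)" by (metis cinner_commute)
  qed
  have "p x = x" if "x \<in> S" for x using that by (intro uniq) (auto simp: cinner_zero_right)
  then have "range p = S" using p(1) by (auto, metis rangeI)
  then show ?thesis using orth by (metis Abs_qproj_inverse mem_Collect_eq)
qed

lemma ran_proj_onto [simp]: "closed_csubspace S \<Longrightarrow> ran_op (proj_onto S) = S"
  unfolding proj_onto_def by (rule theI') (metis projection_exists qproj_eqI)

instantiation qproj :: (complex_hilbert_space) complete_orthomodular_lattice
begin

definition less_eq_qproj :: "'a qproj \<Rightarrow> 'a qproj \<Rightarrow> bool" where
  "P \<le> Q \<longleftrightarrow> ran_op P \<subseteq> ran_op Q"

definition less_qproj :: "'a qproj \<Rightarrow> 'a qproj \<Rightarrow> bool" where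
  "P < Q \<longleftrightarrow> P \<le> Q \<and> \<not> Q \<le> (P :: 'a qproj)"

definition inf_qproj :: "'a qproj \<Rightarrow> 'a qproj \<Rightarrow> 'a qproj" where
  "inf P Q = proj_onto (ran_op P \<inter> ran_op Q)"

definition sup_qproj :: "'a qproj \<Rightarrow> 'a qproj \<Rightarrow> 'a qproj" where
  "sup P Q = proj_onto (closed_cspan (ran_op P \<union> ran_op Q))"

definition Inf_qproj :: "'a qproj set \<Rightarrow> 'a qproj" where
  "Inf A = proj_onto (\<Inter>P\<in>A. ran_op P)"

definition Sup_qproj :: "'a qproj set \<Rightarrow> 'a qproj" where
  "Sup A = proj_onto (closed_cspan (\<Union>P\<in>A. ran_op P))"

lift_definition top_qproj :: "'a qproj" is id
  by (fact orth_projection_id)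

lift_definition bot_qproj :: "'a qproj" is "\<lambda>x. 0"
  by (fact orth_projection_zero)

lift_definition uminus_qproj :: "'a qproj \<Rightarrow> 'a qproj" is "\<lambda>P x. x - P x"
  by (fact orth_projection_compl)

text \<open>This is the lattice difference demanded by the class, not the difference of operators.\<close>
definition minus_qproj :: "'a qproj \<Rightarrow> 'a qproj \<Rightarrow> 'a qproj" where
  "P - Q = inf P (- Q :: 'a qproj)"

instance
proof -
  have ran_inf: "ran_op (inf P Q) = ran_op P \<inter> ran_op Q" for P Q :: "'a qproj"
  proof -
    have "closed_csubspace (\<Inter>{ran_op P, ran_op Q})"
      by (rule closed_csubspace_Inter) (auto simp: closed_csubspace_ran)
    then show ?thesis unfolding inf_qproj_def by simp
  qed
  have ran_sup: "ran_op (sup P Q) = closed_cspan (ran_op P \<union> ran_op Q)" for P Q :: "'a qproj"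
    unfolding sup_qproj_def by (simp add: closed_csubspace_cspan)
  have ran_Inf: "ran_op (Inf A) = (\<Inter>P\<in>A. ran_op P)" for A :: "'a qproj set"
    unfolding Inf_qproj_def by (intro ran_proj_onto closed_csubspace_Inter)
      (auto simp: closed_csubspace_ran)
  have ran_Sup: "ran_op (Sup A) = closed_cspan (\<Union>P\<in>A. ran_op P)" for A :: "'a qproj set"
    unfolding Sup_qproj_def by (simp add: closed_csubspace_cspan)
  have ran_top: "ran_op (top :: 'a qproj) = UNIV" by transfer simp
  have ran_bot: "ran_op (bot :: 'a qproj) = {0}" by transfer auto
  have op_um: "op (- P) x = x - op P x" for P :: "'a qproj" and x by transfer simp
  have ran_um: "x \<in> ran_op (- P) \<longleftrightarrow> op P x = 0" for P :: "'a qproj" and x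
    unfolding mem_ran_op by (simp add: op_um)
  have le_op: "op P (op Q x) = op P x" if "P \<le> Q" for P Q :: "'a qproj" and x
  proof (rule cinner_ext)
    fix z
    have "op Q (op P z) = op P z" using that rangeI[of "op P" z] unfolding less_eq_qproj_def by (metis mem_ran_op subsetD)
    then show "cinner z (op P (op Q x)) = cinner z (op P x)" by (metis op_cinner)
  qed
  have in_sup: "x + y \<in> ran_op (sup P Q)" if "x \<in> ran_op P" "y \<in> ran_op Q"
    for P Q :: "'a qproj" and x y
    using that closed_csubspace_cspan[of "ran_op P \<union> ran_op Q"]
      closed_cspan_superset[of "ran_op P \<union> ran_op Q"]
    unfolding ran_sup closed_csubspace_def csubspace_def by blast
  show "OFCLASS('a qproj, complete_orthomodular_lattice_class)"
  proof
    fix x y z :: "'a qproj" and A :: "'a qproj set"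
    show "(x < y) = (x \<le> y \<and> \<not> y \<le> x)" by (fact less_qproj_def)
    show "x \<le> x" by (simp add: less_eq_qproj_def)
    show "x \<le> y \<Longrightarrow> y \<le> z \<Longrightarrow> x \<le> z" by (auto simp: less_eq_qproj_def)
    show "x \<le> y \<Longrightarrow> y \<le> x \<Longrightarrow> x = y" by (auto simp: less_eq_qproj_def intro: qproj_eqI)
    show "inf x y \<le> x" "inf x y \<le> y" by (auto simp: less_eq_qproj_def ran_inf)
    show "x \<le> y \<Longrightarrow> x \<le> z \<Longrightarrow> x \<le> inf y z" by (auto simp: less_eq_qproj_def ran_inf)
    show "x \<le> sup x y" "y \<le> sup x y"
      using closed_cspan_superset[of "ran_op x \<union> ran_op y"]
      by (auto simp: less_eq_qproj_def ran_sup)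
    show "y \<le> x \<Longrightarrow> z \<le> x \<Longrightarrow> sup y z \<le> x"
      unfolding less_eq_qproj_def ran_sup
      by (rule closed_cspan_minimal) (auto simp: closed_csubspace_ran)
    show "bot \<le> x" unfolding less_eq_qproj_def ran_bot by (simp add: mem_ran_op)
    show "x \<le> top" unfolding less_eq_qproj_def ran_top by simp
    show "x \<in> A \<Longrightarrow> Inf A \<le> x" by (auto simp: less_eq_qproj_def ran_Inf)
    show "(\<And>x. x \<in> A \<Longrightarrow> z \<le> x) \<Longrightarrow> z \<le> Inf A" unfolding less_eq_qproj_def ran_Inf by blast
    show "x \<in> A \<Longrightarrow> x \<le> Sup A"
      using closed_cspan_superset[of "\<Union>P\<in>A. ran_op P"]
      unfolding less_eq_qproj_def ran_Sup by blast
    show "(\<And>x. x \<in> A \<Longrightarrow> x \<le> z) \<Longrightarrow> Sup A \<le> z"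
      unfolding less_eq_qproj_def ran_Sup
      by (rule closed_cspan_minimal) (auto simp: closed_csubspace_ran)
    show "Inf {} = (top :: 'a qproj)" by (rule qproj_eqI) (simp add: ran_Inf ran_top)
    show "Sup {} = (bot :: 'a qproj)"
    proof (rule qproj_eqI)
      have "closed_csubspace ({0} :: 'a set)" using closed_csubspace_ran[of bot] ran_bot by metis
      then have "closed_cspan {} \<subseteq> ({0} :: 'a set)" by (rule closed_cspan_minimal) simp
      then show "ran_op (Sup {}) = ran_op (bot :: 'a qproj)"
        using closed_csubspace_cspan[of "{} :: 'a set"]
        by (auto simp: ran_Sup ran_bot closed_csubspace_def csubspace_def)
    qed
    show "inf x (- x) = bot"
    proof (rule qproj_eqI)
      have "a = 0" if "a \<in> ran_op x" "a \<in> ran_op (- x)" for a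
        using that unfolding ran_um by (simp add: mem_ran_op)
      moreover have "0 \<in> ran_op x" "0 \<in> ran_op (- x)"
        by (simp_all add: mem_ran_op del: rangeI)
      ultimately show "ran_op (inf x (- x)) = ran_op bot"
        unfolding ran_inf ran_bot by blast
    qed
    show "sup x (- x) = top"
    proof (rule qproj_eqI)
      have "a \<in> ran_op (sup x (- x))" for a
        using in_sup[of "op x a" x "a - op x a" "- x"] by (simp add: ran_um op_diff)
      then show "ran_op (sup x (- x)) = ran_op top" by (auto simp: ran_top)
    qed
    show "x - y = inf x (- y)" by (fact minus_qproj_def)
    show "- (- x) = x" by transfer (simp add: fun_eq_iff)
    show "x \<le> y \<Longrightarrow> - y \<le> - x"
      by (metis le_op less_eq_qproj_def op_zero ran_um subsetI)
    assume le: "x \<le> y"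
    show "sup x (inf (- x) y) = y"
    proof (rule qproj_eqI)
      have "sup x (inf (- x) y) \<le> y"
        unfolding less_eq_qproj_def ran_sup
        by (rule closed_cspan_minimal)
          (use le in \<open>auto simp: closed_csubspace_ran ran_inf less_eq_qproj_def\<close>)
      moreover have "a \<in> ran_op (sup x (inf (- x) y))" if a: "a \<in> ran_op y" for a
      proof -
        have "op x a \<in> ran_op y" using le by (auto simp: less_eq_qproj_def)
        then have "a - op x a \<in> ran_op y" using a by (simp add: mem_ran_op op_diff)
        then have "a - op x a \<in> ran_op (inf (- x) y)" by (simp add: ran_inf ran_um op_diff)
        then show ?thesis using in_sup[of "op x a" x "a - op x a" "inf (- x) y"] by simp
      qed
      ultimately show "ran_op (sup x (inf (- x) y)) = ran_op y"
        unfolding less_eq_qproj_def by blast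
    qed
  qed
qed

end

definition commutant :: "'h::complex_hilbert_space qproj set \<Rightarrow> 'h qproj set" where
  "commutant A = {P. \<forall>Q\<in>A. op P \<circ> op Q = op Q \<circ> op P}"

definition is_logic :: "'h::complex_hilbert_space qproj set \<Rightarrow> bool" where
  "is_logic L \<longleftrightarrow> L = commutant (commutant L)"

definition qimp :: "'h::complex_hilbert_space qproj \<Rightarrow> 'h qproj \<Rightarrow> 'h qproj" where
  "qimp P Q = sup (- P) (inf P Q)"

definition qiff :: "'h::complex_hilbert_space qproj \<Rightarrow> 'h qproj \<Rightarrow> 'h qproj" where
  "qiff P Q = inf (qimp P Q) (qimp Q P)"


section \<open>A cumulative universe of labelled sets\<close>

text \<open>
  HOL has no type of all sets.  The type \<open>('k, 'a) lset\<close> is the universe of extensional,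
  well-founded sets of pairs \<open>(x, a)\<close>, where \<open>x\<close> is again such a set and \<open>a :: 'a\<close>, every set
  having at most as many elements as the type \<open>nat + 'k\<close>.  The type \<open>'k\<close> is a free parameter, so
  the universe is closed under countable sets and may be taken as large as desired.  With trivial
  labels it serves as the universe of ordinary sets, with projections as labels it hosts the
  functions that make up the quantum-valued universe.
  It is the quotient of the type of well-founded labelled trees by bisimilarity.
\<close>

datatype ('k, 'a) ltree = Node "nat + 'k \<Rightarrow> (('k, 'a) ltree \<times> 'a) option"

inductive bisim :: "('k, 'a) ltree \<Rightarrow> ('k, 'a) ltree \<Rightarrow> bool" where
  "\<lbrakk>\<And>s a. (s, a) \<in> ran f \<Longrightarrow> \<exists>t. (t, a) \<in> ran g \<and> bisim s t;
    \<And>t a. (t, a) \<in> ran g \<Longrightarrow> \<exists>s. (s, a) \<in> ran f \<and> bisim s t\<rbrakk>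
   \<Longrightarrow> bisim (Node f) (Node g)"

lemma bisim_Node: "bisim (Node f) (Node g) \<longleftrightarrow>
    (\<forall>s a. (s, a) \<in> ran f \<longrightarrow> (\<exists>t. (t, a) \<in> ran g \<and> bisim s t)) \<and>
    (\<forall>t a. (t, a) \<in> ran g \<longrightarrow> (\<exists>s. (s, a) \<in> ran f \<and> bisim s t))"
  by (subst bisim.simps) auto

lemma ltree_ran_induct: "(\<And>f. (\<And>s a. (s, a) \<in> ran f \<Longrightarrow> R s) \<Longrightarrow> R (Node f)) \<Longrightarrow> R t"
proof (induction t)
  case (Node f)
  show ?case
  proof (rule Node.prems)
    fix s a assume "(s, a) \<in> ran f"
    then obtain i where "f i = Some (s, a)" by (auto simp: ran_def)
    then show "R s" using Node.IH[of "Some (s, a)" "(s, a)" s] Node.prems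
      by (metis fsts.intros fst_conv option.set_intros rangeI)
  qed
qed

lemma bisim_refl: "bisim t t"
  by (induction t rule: ltree_ran_induct) (auto simp: bisim_Node)

lemma bisim_sym: "bisim s t \<Longrightarrow> bisim t s"
proof (induction s arbitrary: t rule: ltree_ran_induct)
  case (1 f)
  obtain g where t: "t = Node g" by (cases t)
  show ?case using 1 unfolding t bisim_Node by meson
qed

lemma bisim_trans: "bisim s t \<Longrightarrow> bisim t u \<Longrightarrow> bisim s u"
proof (induction s arbitrary: t u rule: ltree_ran_induct)
  case (1 f)
  obtain g h where t: "t = Node g" "u = Node h" by (cases t, cases u)
  show ?case using 1 unfolding t bisim_Node by meson
qed

quotient_type ('k, 'a) lset = "('k, 'a) ltree" / bisim
  by (intro equivpI reflpI sympI transpI) (fact bisim_refl bisim_sym bisim_trans)+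

definition graph :: "('k, 'a) lset \<Rightarrow> (('k, 'a) lset \<times> 'a) set" where
  "graph u = (case rep_lset u of Node f \<Rightarrow> map_prod abs_lset id ` ran f)"

definition dom_of :: "('k, 'a) lset \<Rightarrow> ('k, 'a) lset set" where
  "dom_of u = fst ` graph u"

definition lset_of :: "(('k, 'a) lset \<times> 'a) set \<Rightarrow> ('k, 'a) lset" where
  "lset_of A = (THE u. graph u = A)"

lemma abs_lset_eq_iff: "abs_lset s = abs_lset t \<longleftrightarrow> bisim s t"
  using lset.abs_eq_iff by blast

lemma graph_abs: "graph (abs_lset (Node f)) = map_prod abs_lset id ` ran f"
proof -
  obtain g where g: "rep_lset (abs_lset (Node f)) = Node g" by (cases "rep_lset (abs_lset (Node f))")
  have b: "bisim (Node g) (Node f)"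
    by (metis Quotient3_abs_rep Quotient3_lset abs_lset_eq_iff g)
  have sub: "map_prod abs_lset id ` ran g \<subseteq> map_prod abs_lset id ` ran f"
    if "bisim (Node g) (Node f)" for f g :: "nat + 'a \<Rightarrow> (('a, 'b) ltree \<times> 'b) option"
  proof
    fix x assume "x \<in> map_prod abs_lset id ` ran g"
    then obtain s a where x: "(s, a) \<in> ran g" "x = (abs_lset s, a)" by auto
    then obtain t where "(t, a) \<in> ran f" "bisim s t"
      using \<open>bisim (Node g) (Node f)\<close> unfolding bisim_Node by metis
    then have "(t, a) \<in> ran f" "x = map_prod abs_lset id (t, a)"
      using x by (simp_all add: abs_lset_eq_iff)
    then show "x \<in> map_prod abs_lset id ` ran f" by blast
  qed
  have "map_prod abs_lset id ` ran g = map_prod abs_lset id ` ran f"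
    using sub[OF b] sub[OF bisim_sym[OF b]] by blast
  then show ?thesis by (simp add: graph_def g)
qed

lemma lset_cases: obtains f where "u = abs_lset (Node f)"
  by (metis Quotient3_abs_rep Quotient3_lset ltree.exhaust)

lemma graph_inject: "graph u = graph v \<longleftrightarrow> u = v"
proof
  obtain f g where uv: "u = abs_lset (Node f)" "v = abs_lset (Node g)" by (metis lset_cases)
  assume "graph u = graph v"
  then have eq: "map_prod abs_lset id ` ran f = map_prod abs_lset id ` ran g"
    by (simp add: uv graph_abs)
  have "\<exists>t. (t, a) \<in> ran g \<and> bisim s t" if "(s, a) \<in> ran f" for s a
  proof -
    have "(abs_lset s, a) \<in> map_prod abs_lset id ` ran g" using that eq by force
    then show ?thesis by (auto simp: abs_lset_eq_iff)
  qed
  moreover have "\<exists>s. (s, a) \<in> ran f \<and> bisim s t" if "(t, a) \<in> ran g" for t a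
  proof -
    have "(abs_lset t, a) \<in> map_prod abs_lset id ` ran f" using that eq by force
    then show ?thesis by (auto simp: abs_lset_eq_iff) (metis bisim_sym)
  qed
  ultimately show "u = v" by (simp add: uv abs_lset_eq_iff bisim_Node)
qed simp

lemma lset_of_graph [simp]: "lset_of (graph u) = u"
  by (simp add: lset_of_def graph_inject)

lemma graph_lset_of_ran:
  fixes f :: "nat + 'k \<Rightarrow> (('k, 'a) lset \<times> 'a) option"
  shows "graph (lset_of (ran f)) = ran f"
proof -
  define g where "g i = map_option (map_prod rep_lset id) (f i)" for i
  have "graph (abs_lset (Node g)) = map_prod abs_lset id ` map_prod rep_lset id ` ran f"
    unfolding graph_abs by (rule arg_cong[of _ _ "(`) _"]) (force simp: g_def ran_def)
  also have "\<dots> = ran f"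
    by (simp add: image_image map_prod.compositionality map_prod.id comp_def
        Quotient3_abs_rep[OF Quotient3_lset] prod.map_ident id_def)
  finally show ?thesis by (metis lset_of_graph)
qed

lemma graph_lset_of_countable:
  assumes "countable A"
  shows "graph (lset_of A :: ('k, 'a) lset) = A"
proof -
  define f where "f i = (case i of Inl n \<Rightarrow>
      if n \<in> to_nat_on A ` A then Some (from_nat_into A n) else None | Inr _ \<Rightarrow> None)" for i :: "nat + 'k"
  have "ran f = A"
  proof
    show "ran f \<subseteq> A"
    proof
      fix x assume "x \<in> ran f"
      then obtain i where "f i = Some x" by (auto simp: ran_def)
      then obtain n where "n \<in> to_nat_on A ` A" "x = from_nat_into A n"
        by (auto simp: f_def split: sum.splits if_splits)
      then show "x \<in> A" using assms by auto
    qed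
    show "A \<subseteq> ran f"
    proof
      fix x assume x: "x \<in> A"
      then have "f (Inl (to_nat_on A x)) = Some x" using assms by (simp add: f_def)
      then show "x \<in> ran f" by (rule ranI)
    qed
  qed
  then show ?thesis using graph_lset_of_ran[of f] by simp
qed

lemma graph_lset_of_image:
  fixes v :: "('k, 'b) lset" and h :: "('k, 'b) lset \<times> 'b \<Rightarrow> ('k, 'a) lset \<times> 'a"
  shows "graph (lset_of (h ` graph v)) = h ` graph v"
proof -
  obtain f where v: "v = abs_lset (Node f)" by (rule lset_cases)
  have "h ` graph v = ran (\<lambda>i. map_option (h \<circ> map_prod abs_lset id) (f i))"
    unfolding v graph_abs by (force simp: ran_def)
  then show ?thesis by (metis graph_lset_of_ran)
qed

lemma wf_dom_of: "wf {(x, u :: ('k, 'a) lset). x \<in> dom_of u}"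
proof (rule wfUNIVI)
  fix R :: "('k, 'a) lset \<Rightarrow> bool" and u
  assume step: "\<forall>u. (\<forall>x. (x, u) \<in> {(x, u). x \<in> dom_of u} \<longrightarrow> R x) \<longrightarrow> R u"
  have "R (abs_lset t)" for t :: "('k, 'a) ltree"
  proof (induction t rule: ltree_ran_induct)
    case (1 f)
    then have "\<And>x. x \<in> dom_of (abs_lset (Node f)) \<Longrightarrow> R x"
      by (auto simp: dom_of_def graph_abs)
    then show ?case using step by blast
  qed
  then show "R u" by (metis lset_cases)
qed

text \<open>Ordinary sets: the members of \<open>x\<close> are the elements of \<open>dom_of x\<close>.\<close>

type_synonym 'k vset = "('k, unit) lset"

definition set_of :: "'k vset set \<Rightarrow> 'k vset" where
  "set_of A = lset_of ((\<lambda>x. (x, ())) ` A)"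

lemma dom_of_set_of: "countable A \<Longrightarrow> dom_of (set_of A) = A"
  by (simp add: set_of_def dom_of_def graph_lset_of_countable image_image)

definition vpair :: "'k vset \<Rightarrow> 'k vset \<Rightarrow> 'k vset" where
  "vpair x y = set_of {set_of {x}, set_of {x, y}}"


section \<open>The quantum-valued universe and truth values\<close>

type_synonym ('k, 'h) name = "('k, 'h qproj) lset"

definition val :: "('k, 'a) lset \<Rightarrow> ('k, 'a) lset \<Rightarrow> 'a" where
  "val u x = (THE p. (x, p) \<in> graph u)"

text \<open>
  The union of the cumulative hierarchy of all functions with values in \<open>L\<close> whose arguments were
  constructed at earlier stages.
\<close>
inductive_set VQ :: "'h::complex_hilbert_space qproj set \<Rightarrow> ('k, 'h) name set"
  for L :: "'h qproj set" where
  "\<lbrakk>single_valued (graph u); \<And>x p. (x, p) \<in> graph u \<Longrightarrow> x \<in> VQ L \<and> p \<in> L\<rbrakk> \<Longrightarrow> u \<in> VQ L"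

function check :: "'k vset \<Rightarrow> ('k, 'h::complex_hilbert_space) name" where
  "check v = lset_of ((\<lambda>w. (check w, top)) ` dom_of v)"
  by pat_completeness auto
termination
  by (relation "{(x, u). x \<in> dom_of u}") (auto simp: wf_dom_of)

function veq :: "('k, 'h::complex_hilbert_space) name \<Rightarrow> ('k, 'h) name \<Rightarrow> 'h qproj"
  and vmem :: "('k, 'h) name \<Rightarrow> ('k, 'h) name \<Rightarrow> 'h qproj"
  where
  "veq u v = inf (INF x\<in>dom_of u. qimp (val u x) (vmem x v))
                 (INF y\<in>dom_of v. qimp (val v y) (vmem y u))"
| "vmem u v = (SUP y\<in>dom_of v. inf (val v y) (veq u y))"
  by pat_completeness auto
termination
proof -
  let ?r = "{(x, u :: ('k, 'h) name). x \<in> dom_of u}"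
  let ?m = "case_sum (\<lambda>(u, v). {#u, v#}) (\<lambda>(u, v). {#u, v#})"
  have 1: "({#x, v#}, {#u, v#}) \<in> mult ?r" if "x \<in> dom_of u" for x u v
    using one_step_implies_mult[of "{#u#}" "{#x#}" ?r "{#v#}"] that by simp
  have 2: "({#x, v#}, {#v, u#}) \<in> mult ?r" "({#v, x#}, {#v, u#}) \<in> mult ?r"
    if "x \<in> dom_of u" for x u v
    using 1[OF that, of v] by (metis add_mset_commute)+
  show ?thesis
  proof (relation "inv_image (mult ?r) ?m")
    show "wf (inv_image (mult ?r) ?m)" by (intro wf_inv_image wf_mult wf_dom_of)
  qed (simp_all only: in_inv_image sum.case prod.case 1 2)
qed

declare check.simps [simp del] veq.simps [simp del] vmem.simps [simp del]

lemma graph_check: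
  fixes v :: "'k vset"
  shows "graph (check v :: ('k, 'h::complex_hilbert_space) name) = (\<lambda>w. (check w, top)) ` dom_of v"
proof -
  let ?h = "\<lambda>z. (check (fst z) :: ('k, 'h) name, top :: 'h qproj)"
  have "(\<lambda>w. (check w, top)) ` dom_of v = ?h ` graph v"
    by (simp add: dom_of_def image_image)
  then show ?thesis using graph_lset_of_image[of ?h v] by (simp add: check.simps[of v])
qed

text \<open>
  Bounded formulas of set theory with names as parameters.  The body of a bounded quantifier is
  represented by its instances.
\<close>
datatype 'n fm =
    Mem 'n 'n
  | Eq 'n 'n
  | Neg "'n fm"
  | Conj "'n fm" "'n fm"
  | Disj "'n fm" "'n fm"
  | Imp "'n fm" "'n fm"
  | Iff "'n fm" "'n fm"
  | BAll 'n "'n \<Rightarrow> 'n fm"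
  | BEx 'n "'n \<Rightarrow> 'n fm"

primrec truth :: "('k, 'h::complex_hilbert_space) name fm \<Rightarrow> 'h qproj" where
  "truth (Mem u v) = vmem u v"
| "truth (Eq u v) = veq u v"
| "truth (Neg \<phi>) = - truth \<phi>"
| "truth (Conj \<phi> \<psi>) = inf (truth \<phi>) (truth \<psi>)"
| "truth (Disj \<phi> \<psi>) = sup (truth \<phi>) (truth \<psi>)"
| "truth (Imp \<phi> \<psi>) = qimp (truth \<phi>) (truth \<psi>)"
| "truth (Iff \<phi> \<psi>) = qiff (truth \<phi>) (truth \<psi>)"
| "truth (BAll u \<phi>) = (INF x\<in>dom_of u. qimp (val u x) (truth (\<phi> x)))"
| "truth (BEx u \<phi>) = (SUP x\<in>dom_of u. inf (val u x) (truth (\<phi> x)))"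

definition Sub_fm :: "'n \<Rightarrow> 'n \<Rightarrow> 'n fm" where
  "Sub_fm x y = BAll x (\<lambda>z. Mem z y)"

text \<open>\<open>w = {x, y}\<close> and \<open>p = {{x}, {x, y}}\<close> as bounded formulas.\<close>

definition Upair_fm :: "'n \<Rightarrow> 'n \<Rightarrow> 'n \<Rightarrow> 'n fm" where
  "Upair_fm w x y = Conj (Conj (Mem x w) (Mem y w)) (BAll w (\<lambda>z. Disj (Eq z x) (Eq z y)))"

definition Pair_fm :: "'n \<Rightarrow> 'n \<Rightarrow> 'n \<Rightarrow> 'n fm" where
  "Pair_fm p x y =
     Conj (Conj (BEx p (\<lambda>w. Upair_fm w x x)) (BEx p (\<lambda>w. Upair_fm w x y)))
          (BAll p (\<lambda>w. Disj (Upair_fm w x x) (Upair_fm w x y)))"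


section \<open>Real numbers\<close>

text \<open>
  \<open>c\<close> codes the rational numbers as sets and is meant to be injective; no particular coding is
  prescribed.  The order of the rationals is the set of Kuratowski pairs of codes, and
  \<open>x < y\<close> is the formula \<open>\<exists>p\<in><. p = (x, y)\<close>.
\<close>

definition rat_set :: "(rat \<Rightarrow> 'k vset) \<Rightarrow> 'k vset" where
  "rat_set c = set_of (range c)"

definition rat_less_set :: "(rat \<Rightarrow> 'k vset) \<Rightarrow> 'k vset" where
  "rat_less_set c = set_of {vpair (c r) (c s) | r s. r < s}"

definition Less_fm ::
  "(rat \<Rightarrow> 'k vset) \<Rightarrow> ('k, 'h::complex_hilbert_space) name \<Rightarrow> ('k, 'h) name \<Rightarrow> ('k, 'h) name fm" where
  "Less_fm c x y = BEx (check (rat_less_set c)) (\<lambda>p. Pair_fm p x y)"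

definition Real_fm ::
  "(rat \<Rightarrow> 'k vset) \<Rightarrow> ('k, 'h::complex_hilbert_space) name \<Rightarrow> ('k, 'h) name fm" where
  "Real_fm c x =
     (let Q = check (rat_set c) in
      Conj (Sub_fm x Q)
     (Conj (BEx Q (\<lambda>y. Mem y x))
     (Conj (BEx Q (\<lambda>y. Neg (Mem y x)))
           (BAll Q (\<lambda>y. Iff (Mem y x) (BAll Q (\<lambda>z. Imp (Less_fm c y z) (Mem z x))))))))"

definition RQ ::
  "(rat \<Rightarrow> 'k vset) \<Rightarrow> 'h::complex_hilbert_space qproj set \<Rightarrow> ('k, 'h) name set" where
  "RQ c L = {u \<in> VQ L. dom_of u = range (\<lambda>r. check (c r)) \<and> truth (Real_fm c u) = top}"

end

(* Since distinct check names are equal with truth value bot, each [check r in u] is just u(check r),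
   so [u = v] is the meet over r of the biconditionals of u(check r) and v(check r).  The range of
   P => Q consists of the psi with P psi in ran Q, and if both P psi is in ran Q and Q psi is in
   ran P, then |P psi - Q psi|^2 = 0; hence ran (P <=> Q) is the equalizer of P and Q. *)
theory Submission
  imports Defs
begin

lemma proj_onto_ran: "proj_onto (ran_op P) = P"
  by (rule qproj_eqI) (simp add: closed_csubspace_ran)

lemma ran_mono: "P \<le> Q \<Longrightarrow> x \<in> ran_op P \<Longrightarrow> x \<in> ran_op Q"
  by (auto simp: less_eq_qproj_def)

lemma ran_inf: "ran_op (inf P Q) = ran_op P \<inter> ran_op Q"
proof -
  have "closed_csubspace (\<Inter>{ran_op P, ran_op Q})"
    by (rule closed_csubspace_Inter) (auto simp: closed_csubspace_ran)
  then show ?thesis unfolding inf_qproj_def by simp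
qed

lemma ran_Inf: "ran_op (Inf A) = (\<Inter>P\<in>A. ran_op P)"
  unfolding Inf_qproj_def
  by (intro ran_proj_onto closed_csubspace_Inter) (auto simp: closed_csubspace_ran)

lemma ran_add: "x \<in> ran_op P \<Longrightarrow> y \<in> ran_op P \<Longrightarrow> x + y \<in> ran_op P"
  unfolding mem_ran_op by (simp add: op_add)

lemma op_uminus: "op (- P) x = x - op P x"
  by transfer simp

lemma ran_uminus: "x \<in> ran_op (- P) \<longleftrightarrow> op P x = 0"
  unfolding mem_ran_op by (simp add: op_uminus)

lemma ran_qimp: "x \<in> ran_op (qimp P Q) \<longleftrightarrow> op P x \<in> ran_op Q"
proof
  assume x: "x \<in> ran_op (qimp P Q)"
  let ?M = "inf P Q"
  \<comment> \<open>The component of \<open>op P x\<close> outside \<open>P \<and> Q\<close> lies in the orthocomplement of \<open>qimp P Q\<close>.\<close>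
  define y where "y = op P x - op ?M (op P x)"
  have "op ?M (op P x) \<in> ran_op P" using ran_inf[of P Q] by blast
  then have yP: "op P y = y" unfolding mem_ran_op by (simp add: y_def op_diff)
  have yM: "op ?M y = 0" by (simp add: y_def op_diff)
  have "- qimp P Q = inf P (- ?M)" by (simp add: qimp_def compl_sup)
  then have "y \<in> ran_op (- qimp P Q)"
    using yP yM by (metis IntI mem_ran_op ran_inf ran_uminus)
  then have "op (qimp P Q) y = 0" by (simp only: ran_uminus)
  moreover have "op (qimp P Q) x = x" using x by (simp only: mem_ran_op)
  \<comment> \<open>The projection \<open>qimp P Q\<close> fixes \<open>x\<close> and kills
    \<open>y\<close>. The two summands of \<open>y\<close>, \<open>op P x\<close> and its projection
    to \<open>ran_op ?M\<close>, are then both orthogonal to \<open>y\<close>, so \<open>y\<close>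
    is orthogonal to itself.\<close>
  ultimately have "cinner x y = 0"
    using op_cinner[of "qimp P Q" x y] by (simp add: cinner_zero_right)
  then have "cinner (op P x) y = 0" by (simp add: op_cinner yP)
  moreover have "cinner (op ?M (op P x)) y = 0"
    by (simp add: op_cinner yM cinner_zero_right)
  ultimately have "cinner y y = 0"
    using cinner_diff_left[of "op P x" "op ?M (op P x)" y] by (simp flip: y_def)
  then have "y = 0" by (rule cinner_self_eq_0)
  then have "op ?M (op P x) = op P x" unfolding y_def by (metis eq_iff_diff_eq_0)
  then have "op P x \<in> ran_op ?M" by (simp only: mem_ran_op)
  then show "op P x \<in> ran_op Q" by (simp add: ran_inf)
next
  assume "op P x \<in> ran_op Q"
  \<comment> \<open>Split \<open>x\<close> into \<open>op P x\<close> and \<open>x - op P x\<close>;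
    they lie in the ranges of \<open>inf P Q\<close> and \<open>- P\<close>, both below
    \<open>qimp P Q\<close>.\<close>
  then have "op P x \<in> ran_op (inf P Q)" by (simp add: ran_inf)
  then have "op P x \<in> ran_op (qimp P Q)" by (rule ran_mono[rotated]) (simp add: qimp_def)
  moreover have "x - op P x \<in> ran_op (- P)" by (simp add: ran_uminus op_diff)
  then have "x - op P x \<in> ran_op (qimp P Q)" by (rule ran_mono[rotated]) (simp add: qimp_def)
  ultimately show "x \<in> ran_op (qimp P Q)" by (metis ran_add diff_add_cancel)
qed

lemma ran_qiff: "x \<in> ran_op (qiff P Q) \<longleftrightarrow> op P x = op Q x"
proof
  assume "x \<in> ran_op (qiff P Q)"
  then have "op P x \<in> ran_op Q" "op Q x \<in> ran_op P"
    by (simp_all add: qiff_def ran_inf ran_qimp)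
  then have *: "op Q (op P x) = op P x" "op P (op Q x) = op Q x" unfolding mem_ran_op .
  \<comment> \<open>By self-adjointness and \<open>*\<close>, the four terms of the expanded square
    reduce to two inner products with \<open>x\<close>, each occurring once with either
    sign.\<close>
  have "cinner (op P x) (op Q x) = cinner x (op Q x)" "cinner (op Q x) (op P x) = cinner x (op P x)"
    "cinner (op P x) (op P x) = cinner x (op P x)" "cinner (op Q x) (op Q x) = cinner x (op Q x)"
    by (simp_all add: op_cinner *)
  then have "cinner (op P x - op Q x) (op P x - op Q x) = 0"
    by (simp add: cinner_diff_left cinner_diff_right)
  then show "op P x = op Q x" using cinner_self_eq_0 by force
next
  assume "op P x = op Q x"
  then have "op P x \<in> ran_op Q" "op Q x \<in> ran_op P"
    by (metis rangeI)+
  then show "x \<in> ran_op (qiff P Q)" by (simp add: qiff_def ran_inf ran_qimp)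
qed

lemma qimp_top_left [simp]: "qimp top P = P"
  by (simp add: qimp_def)

text \<open>Every term away from \<open>a\<close> is \<open>bot\<close>. This evaluates a membership
  in which only one element of the domain can contribute.\<close>

lemma SUP_inf_indicator:
  fixes f :: "'b \<Rightarrow> 'a::complete_lattice"
  assumes "a \<in> A"
  shows "(SUP x\<in>A. inf (f x) (if x = a then top else bot)) = f a"
proof (rule antisym)
  show "(SUP x\<in>A. inf (f x) (if x = a then top else bot)) \<le> f a"
    by (rule SUP_least) simp
  show "f a \<le> (SUP x\<in>A. inf (f x) (if x = a then top else bot))"
    by (rule SUP_upper2[OF assms]) simp
qed

lemma INF_indicator:
  "(INF x\<in>A. if P x then top else bot) = (if \<forall>x\<in>A. P x then top else bot :: 'a::complete_lattice)"
proof (cases "\<forall>x\<in>A. P x")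
  case False
  then obtain a where "a \<in> A" "\<not> P a" by blast
  then have "(INF x\<in>A. if P x then top else bot :: 'a) = bot"
    using INF_lower[of a A "\<lambda>x. if P x then top else bot :: 'a"] by (simp add: bot_unique)
  with False show ?thesis by (simp only: if_False)
qed simp

lemma dom_of_check: "dom_of (check x) = check ` dom_of x"
  by (simp add: dom_of_def graph_check image_image)

lemma val_check: "w \<in> dom_of x \<Longrightarrow> val (check x) (check w) = top"
  unfolding val_def graph_check by (rule the_equality) auto

text \<open>The only label is \<open>()\<close>, so the domain determines the graph.\<close>

lemma vset_eqI: "dom_of x = dom_of y \<Longrightarrow> x = (y :: 'k vset)"
proof -
  have "graph z = (\<lambda>w. (w, ())) ` dom_of z" for z :: "'k vset"
    by (force simp: dom_of_def)
  then show "dom_of x = dom_of y \<Longrightarrow> x = y" by (metis graph_inject)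
qed

lemma veq_commute: "veq u v = veq v u"
  unfolding veq.simps[of u v] veq.simps[of v u] by (rule inf_commute)

lemma vmem_check_right: "vmem u (check y) = (SUP w\<in>dom_of y. veq u (check w))"
  by (simp add: vmem.simps dom_of_check image_image val_check)

text \<open>By induction on membership all truth values involved are \<open>top\<close> or
  \<open>bot\<close>, and the defining infima then express extensionality of ordinary sets.\<close>

lemma veq_check:
  fixes x y :: "'k vset"
  shows "veq (check x) (check y) =
    (if x = y then top else bot :: 'h::complex_hilbert_space qproj)"
proof (induction x arbitrary: y rule: wf_induct_rule[OF wf_dom_of])
  case (1 x)
  have IH: "veq (check w) (check z) = (if w = z then top else bot :: 'h qproj)"
    if "w \<in> dom_of x" for w z
    using 1 that by blast
  have l: "vmem (check w) (check y) = (if w \<in> dom_of y then top else bot :: 'h qproj)"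
    if "w \<in> dom_of x" for w
    by (auto simp: vmem_check_right IH[OF that] intro!: antisym SUP_least SUP_upper2[of w])
  \<comment> \<open>Here the members of \<open>x\<close> appear on the right of \<open>veq\<close>;
    symmetry moves them to the left, where the induction hypothesis applies.\<close>
  have r: "vmem (check w) (check x) = (if w \<in> dom_of x then top else bot :: 'h qproj)" for w
    by (auto simp: vmem_check_right veq_commute[of "check w"] IH
        intro!: antisym SUP_least SUP_upper2[of w])
  have "veq (check x) (check y) =
    inf (INF w\<in>dom_of x. if w \<in> dom_of y then top else bot :: 'h qproj)
        (INF w\<in>dom_of y. if w \<in> dom_of x then top else bot)"
    by (simp add: veq.simps dom_of_check image_image val_check l r)
  also have "\<dots> = (if dom_of x = dom_of y then top else bot)"
    unfolding INF_indicator by auto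
  also have "dom_of x = dom_of y \<longleftrightarrow> x = y" using vset_eqI by blast
  finally show ?case .
qed

text \<open>Distinct check names are equal with value \<open>bot\<close>, so only the term at
  \<open>check x\<close> survives in the supremum.\<close>

lemma vmem_check_left:
  fixes u :: "('k, 'h::complex_hilbert_space) name"
  assumes "dom_of u \<subseteq> range check" and "check x \<in> dom_of u"
  shows "vmem (check x) u = val u (check x)"
proof -
  have "veq (check x) w = (if w = check x then top else bot :: 'h qproj)" if w: "w \<in> dom_of u" for w
  proof -
    obtain z where z: "w = check z" using w assms(1) by blast
    show ?thesis
    proof (cases "x = z")
      case False
      \<comment> \<open>\<open>check x = check z\<close> would give the equality the value \<open>top\<close>, so \<open>top = bot\<close>.\<close>
      then show ?thesis using veq_check[of x x, where 'h='h] veq_check[of x z, where 'h='h] z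
        by auto
    qed (simp add: z veq_check)
  qed
  then have "vmem (check x) u =
      (SUP w\<in>dom_of u. inf (val u w) (if w = check x then top else bot))"
    unfolding vmem.simps by (intro SUP_cong) auto
  then show ?thesis by (simp only: SUP_inf_indicator[OF assms(2)])
qed

theorem theorem5p5:
  fixes c :: "rat \<Rightarrow> 'k vset"
    and L :: "'h::complex_hilbert_space qproj set"
    and u v :: "('k, 'h) name"
  assumes "inj c"
    and "is_logic L"
    and "u \<in> RQ c L" and "v \<in> RQ c L"
  shows "truth (Eq u v) =
    proj_onto {\<psi>. \<forall>r. op (truth (Mem (check (c r)) u)) \<psi> = op (truth (Mem (check (c r)) v)) \<psi>}"
proof -
  have dom: "dom_of u = range (\<lambda>r. check (c r))" "dom_of v = range (\<lambda>r. check (c r))"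
    using assms(3,4) by (simp_all add: RQ_def)
  have mem: "val u (check (c r)) = vmem (check (c r)) u" "val v (check (c r)) = vmem (check (c r)) v"
    for r
    using dom by (auto intro!: vmem_check_left[symmetric])
  \<comment> \<open>Both infima in \<open>veq\<close> run over the same names, so they merge into
    one infimum of pairs of opposite implications.\<close>
  have "veq u v = (INF r. qiff (vmem (check (c r)) u) (vmem (check (c r)) v))"
    unfolding veq.simps[of u v] dom by (simp add: image_image mem qiff_def INF_inf_distrib)
  then have "ran_op (veq u v) =
      {\<psi>. \<forall>r. op (vmem (check (c r)) u) \<psi> = op (vmem (check (c r)) v) \<psi>}"
    by (auto simp only: ran_Inf ran_qiff INT_iff image_image UNIV_I INT_simps mem_Collect_eq)
  then show ?thesis using proj_onto_ran[of "veq u v"] by simp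
qed

end
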